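(* Let $\delta\in\mathbb{C}$ and let $(N,\cdot,\circ)$ be a $\delta$-Novikov--Poisson algebra over $\mathbb{C}$. For any fixed elements $q,h\in N$, define two new operations on $N$ by $$x\cdot_q y=qxy\quad\text{and}\quad x\times_h y=x\circ y+hxy.$$ Then $(N,\cdot_q,\times_h)$ is a $\delta$-Novikov--Poisson algebra.
   Context: A (left) $\delta$-Novikov algebra is an algebra $(N,\circ)$ satisfying $\delta(x\circ y)\circ z-x\circ(y\circ z)=\delta(y\circ x)\circ z-y\circ(x\circ z)$ and $(x\circ y)\circ z=(x\circ z)\circ y$. A $\delta$-Novikov--Poisson algebra is a vector space $N$ with two bilinear operations $\cdot$ (also written by juxtaposition) and $\circ$ such that $(N,\cdot)$ is a commutative associative algebra, $(N,\circ)$ is a $\delta$-Novikov algebra, and for all $x,y,z\in N$: $(xy)\circ z=x(y\circ z)$ and $\delta(x\circ y)z-x\circ(yz)=\delta(y\circ x)z-y\circ(xz)$. *)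

theory Defs
  imports Complex_Main
begin

locale nonassoc_algebra = vector_space scale
  for scale :: "'f::field \<Rightarrow> 'a::ab_group_add \<Rightarrow> 'a"
  and prod :: "'a \<Rightarrow> 'a \<Rightarrow> 'a" +
  assumes linear_right: "Vector_Spaces.linear scale scale (\<lambda>y. prod x y)"
      and linear_left: "Vector_Spaces.linear scale scale (\<lambda>x. prod x y)"

locale comm_assoc_algebra = nonassoc_algebra scale mul + abel_semigroup mul
  for scale :: "'f::field \<Rightarrow> 'a::ab_group_add \<Rightarrow> 'a"
  and mul :: "'a \<Rightarrow> 'a \<Rightarrow> 'a"

locale delta_Novikov_algebra = nonassoc_algebra scale circ
  for \<delta> :: "'f::field"
  and scale :: "'f \<Rightarrow> 'a::ab_group_add \<Rightarrow> 'a"  (infixr \<open>*s\<close> 75)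
  and circ :: "'a \<Rightarrow> 'a \<Rightarrow> 'a"  (infixl \<open>\<odot>\<close> 70) +
  assumes delta_left_symmetric:
        "\<delta> *s ((x \<odot> y) \<odot> z) - x \<odot> (y \<odot> z) = \<delta> *s ((y \<odot> x) \<odot> z) - y \<odot> (x \<odot> z)"
      and right_commutative: "(x \<odot> y) \<odot> z = (x \<odot> z) \<odot> y"

locale delta_Novikov_Poisson_algebra =
  mul: comm_assoc_algebra scale mul + circ: delta_Novikov_algebra \<delta> scale circ
  for \<delta> :: "'f::field"
  and scale :: "'f \<Rightarrow> 'a::ab_group_add \<Rightarrow> 'a"  (infixr \<open>*s\<close> 75)
  and mul :: "'a \<Rightarrow> 'a \<Rightarrow> 'a"  (infixl \<open>\<cdot>\<close> 70)
  and circ :: "'a \<Rightarrow> 'a \<Rightarrow> 'a"  (infixl \<open>\<odot>\<close> 70) +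
  assumes mul_circ: "(x \<cdot> y) \<odot> z = x \<cdot> (y \<odot> z)"
      and delta_compat:
        "\<delta> *s ((x \<odot> y) \<cdot> z) - x \<odot> (y \<cdot> z) = \<delta> *s ((y \<odot> x) \<cdot> z) - y \<odot> (x \<cdot> z)"

end

theory Submission
  imports Defs
begin

text \<open>
  All axioms of the deformed algebra are polynomial in \<open>q\<close> and \<open>h\<close>, and they can be checked
  one coefficient at a time.
  The \<open>q\<close>-deformation costs nothing: wherever \<open>q\<close> occurs it can be absorbed into one of the other
  arguments of the corresponding original axiom, for instance by putting \<open>q \<cdot> z\<close> for \<open>z\<close> in
  \<open>delta_compat\<close>.

  The perturbation \<open>x \<times> y = x \<odot> y + h \<cdot> x \<cdot> y\<close> of the Novikov product needs one more fact:
  since \<open>\<cdot>\<close> is commutative, \<open>(x \<cdot> y) \<odot> z\<close> can be expanded in two ways, so that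
  \<open>x \<cdot> (y \<odot> z) = y \<cdot> (x \<odot> z)\<close> (\<open>mul_circ_left_commute\<close>).
  With it, the coefficient of order one in \<open>h\<close> in \<open>\<delta> *s ((x \<times> y) \<times> z) - x \<times> (y \<times> z)\<close> is the sum of
  the \<open>delta_compat\<close> expression and of a multiple of \<open>h \<cdot> x \<cdot> (y \<odot> z)\<close>, both symmetric in \<open>x\<close> and \<open>y\<close>;
  the coefficient of order two is a multiple of \<open>h \<cdot> h \<cdot> x \<cdot> y \<cdot> z\<close>
  (\<open>perturbed_left_symmetric\<close>).
\<close>

lemma nonassoc_algebraI:
  fixes scale :: "'f::field \<Rightarrow> 'a::ab_group_add \<Rightarrow> 'a" and prod :: "'a \<Rightarrow> 'a \<Rightarrow> 'a"
  assumes "vector_space scale"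
    and "\<And>x y z. prod x (y + z) = prod x y + prod x z"
    and "\<And>x y z. prod (x + y) z = prod x z + prod y z"
    and "\<And>c x y. prod x (scale c y) = scale c (prod x y)"
    and "\<And>c x y. prod (scale c x) y = scale c (prod x y)"
  shows "nonassoc_algebra scale prod"
  using assms
  by (simp add: nonassoc_algebra_def nonassoc_algebra_axioms_def Vector_Spaces.linear_iff)

context nonassoc_algebra
begin

lemma prod_add_right: "prod x (y + z) = prod x y + prod x z"
  using linear_right[of x] by (simp add: Vector_Spaces.linear_iff)

lemma prod_add_left: "prod (x + y) z = prod x z + prod y z"
  using linear_left[of z] by (simp add: Vector_Spaces.linear_iff)

lemma prod_scale_right: "prod x (scale c y) = scale c (prod x y)"
  using linear_right[of x] by (simp add: Vector_Spaces.linear_iff)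

lemma prod_scale_left: "prod (scale c x) y = scale c (prod x y)"
  using linear_left[of y] by (simp add: Vector_Spaces.linear_iff)

lemmas bilinear_simps = prod_add_right prod_add_left prod_scale_right prod_scale_left

end

context delta_Novikov_Poisson_algebra
begin

lemma mul_circ_left_commute: "x \<cdot> (y \<odot> z) = y \<cdot> (x \<odot> z)"
  by (metis mul.commute mul_circ)

lemma comm_assoc_algebra_scaled_mul: "comm_assoc_algebra scale (\<lambda>x y. q \<cdot> x \<cdot> y)"
proof (intro comm_assoc_algebra.intro nonassoc_algebraI)
  show "vector_space scale" ..
  show "abel_semigroup (\<lambda>x y. q \<cdot> x \<cdot> y)"
    by unfold_locales (simp_all add: mul.assoc mul.commute mul.left_commute)
qed (simp_all add: mul.bilinear_simps)

lemma perturbed_right_commutative: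
  "(x \<odot> y + h \<cdot> x \<cdot> y) \<odot> z + h \<cdot> (x \<odot> y + h \<cdot> x \<cdot> y) \<cdot> z =
   (x \<odot> z + h \<cdot> x \<cdot> z) \<odot> y + h \<cdot> (x \<odot> z + h \<cdot> x \<cdot> z) \<cdot> y"
proof -
  \<comment> \<open>The two mixed terms are \<open>h \<cdot> y \<cdot> (x \<odot> z)\<close> and \<open>h \<cdot> z \<cdot> (x \<odot> y)\<close>: they are exchanged
    by \<open>y \<leftrightarrow> z\<close>.\<close>
  have expand: "(x \<odot> u + h \<cdot> x \<cdot> u) \<odot> v + h \<cdot> (x \<odot> u + h \<cdot> x \<cdot> u) \<cdot> v =
      (x \<odot> u) \<odot> v + (h \<cdot> (u \<cdot> (x \<odot> v)) + h \<cdot> (v \<cdot> (x \<odot> u))) + h \<cdot> (h \<cdot> (x \<cdot> (u \<cdot> v)))" for u v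
    by (simp add: mul.bilinear_simps circ.bilinear_simps mul_circ mul.assoc mul.commute
        mul.left_commute mul_circ_left_commute[of x u v])
  show ?thesis
    unfolding expand by (simp add: circ.right_commutative[of x y z] add.commute mul.commute[of y z])
qed

text \<open>
  After expansion three groups of terms remain, each symmetric in \<open>x\<close> and \<open>y\<close>: the left-symmetry
  expression of \<open>\<odot>\<close>, the compatibility expression at \<open>h \<cdot> z\<close>, and multiples of elements that are
  symmetric themselves.
\<close>
lemma perturbed_left_symmetric:
  "\<delta> *s ((x \<odot> y + h \<cdot> x \<cdot> y) \<odot> z + h \<cdot> (x \<odot> y + h \<cdot> x \<cdot> y) \<cdot> z)
     - (x \<odot> (y \<odot> z + h \<cdot> y \<cdot> z) + h \<cdot> x \<cdot> (y \<odot> z + h \<cdot> y \<cdot> z)) =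
   \<delta> *s ((y \<odot> x + h \<cdot> y \<cdot> x) \<odot> z + h \<cdot> (y \<odot> x + h \<cdot> y \<cdot> x) \<cdot> z)
     - (y \<odot> (x \<odot> z + h \<cdot> x \<cdot> z) + h \<cdot> y \<cdot> (x \<odot> z + h \<cdot> x \<cdot> z))"
proof -
  have expand:
    "\<delta> *s ((u \<odot> v + h \<cdot> u \<cdot> v) \<odot> z + h \<cdot> (u \<odot> v + h \<cdot> u \<cdot> v) \<cdot> z)
       - (u \<odot> (v \<odot> z + h \<cdot> v \<cdot> z) + h \<cdot> u \<cdot> (v \<odot> z + h \<cdot> v \<cdot> z)) =
     (\<delta> *s ((u \<odot> v) \<odot> z) - u \<odot> (v \<odot> z))
     + (\<delta> *s ((u \<odot> v) \<cdot> (h \<cdot> z)) - u \<odot> (v \<cdot> (h \<cdot> z)))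
     + (\<delta> *s (h \<cdot> (u \<cdot> (v \<odot> z))) - h \<cdot> (u \<cdot> (v \<odot> z)))
     + (\<delta> *s (h \<cdot> (h \<cdot> (u \<cdot> (v \<cdot> z)))) - h \<cdot> (h \<cdot> (u \<cdot> (v \<cdot> z))))" for u v
    by (simp add: mul.bilinear_simps circ.bilinear_simps mul_circ mul.assoc mul.commute
        mul.left_commute mul.scale_right_distrib algebra_simps)
  show ?thesis
    unfolding expand circ.delta_left_symmetric[of x y z] delta_compat[of x y "h \<cdot> z"]
      mul_circ_left_commute[of x y z] mul.left_commute[of x y z] ..
qed

lemma delta_Novikov_algebra_perturbed_circ:
  "delta_Novikov_algebra \<delta> scale (\<lambda>x y. x \<odot> y + h \<cdot> x \<cdot> y)"
proof (intro delta_Novikov_algebra.intro delta_Novikov_algebra_axioms.intro nonassoc_algebraI)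
  show "vector_space scale" ..
qed (simp_all only: perturbed_left_symmetric perturbed_right_commutative,
     simp_all add: mul.bilinear_simps circ.bilinear_simps mul.scale_right_distrib algebra_simps)

lemma deformed_mul_circ:
  "q \<cdot> x \<cdot> y \<odot> z + h \<cdot> (q \<cdot> x \<cdot> y) \<cdot> z = q \<cdot> x \<cdot> (y \<odot> z + h \<cdot> y \<cdot> z)"
  by (simp add: mul.bilinear_simps mul_circ mul.assoc mul.left_commute)

lemma deformed_delta_compat:
  "\<delta> *s (q \<cdot> (x \<odot> y + h \<cdot> x \<cdot> y) \<cdot> z) - (x \<odot> (q \<cdot> y \<cdot> z) + h \<cdot> x \<cdot> (q \<cdot> y \<cdot> z)) =
   \<delta> *s (q \<cdot> (y \<odot> x + h \<cdot> y \<cdot> x) \<cdot> z) - (y \<odot> (q \<cdot> x \<cdot> z) + h \<cdot> y \<cdot> (q \<cdot> x \<cdot> z))"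
proof -
  have expand:
    "\<delta> *s (q \<cdot> (u \<odot> v + h \<cdot> u \<cdot> v) \<cdot> z) - (u \<odot> (q \<cdot> v \<cdot> z) + h \<cdot> u \<cdot> (q \<cdot> v \<cdot> z)) =
     (\<delta> *s ((u \<odot> v) \<cdot> (q \<cdot> z)) - u \<odot> (v \<cdot> (q \<cdot> z)))
     + (\<delta> *s (h \<cdot> (q \<cdot> (u \<cdot> (v \<cdot> z)))) - h \<cdot> (q \<cdot> (u \<cdot> (v \<cdot> z))))" for u v
    by (simp add: mul.bilinear_simps mul.assoc mul.commute
        mul.left_commute mul.scale_right_distrib algebra_simps)
  show ?thesis
    unfolding expand delta_compat[of x y "q \<cdot> z"] mul.left_commute[of x y z] ..
qed

theorem delta_Novikov_Poisson_deformation: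
  "delta_Novikov_Poisson_algebra \<delta> scale
     (\<lambda>x y. q \<cdot> x \<cdot> y) (\<lambda>x y. x \<odot> y + h \<cdot> x \<cdot> y)"
  by (intro delta_Novikov_Poisson_algebra.intro delta_Novikov_Poisson_algebra_axioms.intro
      comm_assoc_algebra_scaled_mul delta_Novikov_algebra_perturbed_circ
      deformed_mul_circ deformed_delta_compat)

end

theorem theorem23:
  fixes \<delta> :: complex
    and scale :: "complex \<Rightarrow> 'a::ab_group_add \<Rightarrow> 'a"
    and mul :: "'a \<Rightarrow> 'a \<Rightarrow> 'a"  (infixl \<open>\<cdot>\<close> 70)
    and circ :: "'a \<Rightarrow> 'a \<Rightarrow> 'a"  (infixl \<open>\<odot>\<close> 70)
    and q h :: 'a
  assumes "delta_Novikov_Poisson_algebra \<delta> scale mul circ"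
  shows "delta_Novikov_Poisson_algebra \<delta> scale
           (\<lambda>x y. q \<cdot> x \<cdot> y) (\<lambda>x y. x \<odot> y + h \<cdot> x \<cdot> y)"
  using assms by (rule delta_Novikov_Poisson_algebra.delta_Novikov_Poisson_deformation)

end
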